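(* Let $R$ be a semiprime left noetherian ring and let $\sigma$ be an endomorphism of $R$ having a large image. The following conditions are equivalent: (1) $\sigma$ is injective; (2) $\sigma(\mathcal{C}(R))\subseteq \mathcal{C}(R)$; (3) there exists a regular element $c\in R$ such that $Rc\subseteq\sigma(R)$ and $\sigma^n(c)$ is regular in $R$ for every $n\in\mathbb{N}$; (4) $\sigma^n$ has a large image for every $n\in\mathbb{N}$.
   Context: Rings are associative with unity, not necessarily commutative. For a subset $S\subseteq R$, $\mathrm{rann}_R(S)=\{a\in R\mid Sa=0\}$ is the right annihilator. An endomorphism $\sigma$ of a ring $R$ has a large image if $\sigma(R)$ contains an essential left ideal $L$ of $R$ with $\mathrm{rann}_R(L)=0$. $\mathcal{C}(R)$ denotes the set of all regular elements of $R$ (elements that are neither left nor right zero divisors). *)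

theory Defs
  imports "HOL-Algebra.Ideal_Product"
begin

definition left_ideal :: "'a set \<Rightarrow> ('a, 'b) ring_scheme \<Rightarrow> bool" where
  "left_ideal I R \<longleftrightarrow>
    additive_subgroup I R \<and> (\<forall>r\<in>carrier R. \<forall>a\<in>I. r \<otimes>\<^bsub>R\<^esub> a \<in> I)"

definition essential_left_ideal :: "'a set \<Rightarrow> ('a, 'b) ring_scheme \<Rightarrow> bool" where
  "essential_left_ideal L R \<longleftrightarrow>
    left_ideal L R \<and> (\<forall>I. left_ideal I R \<and> I \<noteq> {\<zero>\<^bsub>R\<^esub>} \<longrightarrow> L \<inter> I \<noteq> {\<zero>\<^bsub>R\<^esub>})"

text \<open>The library's \<open>noetherian_ring\<close> concerns two-sided ideals only.\<close>

definition left_noetherian :: "('a, 'b) ring_scheme \<Rightarrow> bool" where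
  "left_noetherian R \<longleftrightarrow>
    (\<forall>I :: nat \<Rightarrow> 'a set. (\<forall>n. left_ideal (I n) R) \<and> (\<forall>n. I n \<subseteq> I (Suc n))
      \<longrightarrow> (\<exists>N. \<forall>n\<ge>N. I n = I N))"

text \<open>The zero ideal is a semiprime ideal: a two-sided ideal with zero square is zero.\<close>

definition semiprime_ring :: "('a, 'b) ring_scheme \<Rightarrow> bool" where
  "semiprime_ring R \<longleftrightarrow>
    (\<forall>I. ideal I R \<and> I \<cdot>\<^bsub>R\<^esub> I = {\<zero>\<^bsub>R\<^esub>} \<longrightarrow> I = {\<zero>\<^bsub>R\<^esub>})"

definition rann :: "('a, 'b) ring_scheme \<Rightarrow> 'a set \<Rightarrow> 'a set" where
  "rann R S = {a \<in> carrier R. \<forall>s\<in>S. s \<otimes>\<^bsub>R\<^esub> a = \<zero>\<^bsub>R\<^esub>}"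

text \<open>Here \<open>\<zero>\<close> counts as a zero divisor unless the ring is trivial.\<close>

definition regular_elements :: "('a, 'b) ring_scheme \<Rightarrow> 'a set" where
  "regular_elements R =
    {c \<in> carrier R. \<forall>b\<in>carrier R.
      (c \<otimes>\<^bsub>R\<^esub> b = \<zero>\<^bsub>R\<^esub> \<longrightarrow> b = \<zero>\<^bsub>R\<^esub>) \<and> (b \<otimes>\<^bsub>R\<^esub> c = \<zero>\<^bsub>R\<^esub> \<longrightarrow> b = \<zero>\<^bsub>R\<^esub>)}"

definition large_image :: "('a, 'b) ring_scheme \<Rightarrow> ('a \<Rightarrow> 'a) \<Rightarrow> bool" where
  "large_image R \<sigma> \<longleftrightarrow>
    (\<exists>L. essential_left_ideal L R \<and> L \<subseteq> \<sigma> ` carrier R \<and> rann R L = {\<zero>\<^bsub>R\<^esub>})"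

end

theory Submission
  imports Defs
begin

text \<open>
  The proof runs in a cycle: an injective \<open>\<sigma>\<close> preserves regular elements, this yields the element
  \<open>c\<close>, from \<open>c\<close> one gets large images of all powers, and these force \<open>\<sigma>\<close> to be injective.

  The ring theory needed is a part of Goldie's theory for a semiprime left noetherian ring \<open>R\<close>.
  An element with zero left annihilator generates an essential left ideal
  (\<open>essential_principal_if_lann_zero\<close>), and no nonzero element has an essential left annihilator
  (\<open>nonsingular\<close>). Together these make an element with zero left annihilator regular on both
  sides (\<open>regular_if_lann_zero\<close>). Moreover nonzero left ideals are not nil
  (\<open>nil_left_ideal_zero\<close>), and hence every essential left ideal contains a regular element
  (\<open>essential_left_ideal_contains_regular\<close>). The chain condition always enters as the existence
  of maximal members of families of left ideals.

  Let \<open>L\<close> be an essential left ideal inside the image of \<open>\<sigma>\<close>. If \<open>\<sigma>\<close> is injective and \<open>c\<close> is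
  regular, then \<open>lann (\<sigma> c)\<close> meets \<open>L\<close> trivially, so \<open>\<sigma> c\<close> has zero left annihilator and is
  regular. If \<open>\<sigma>\<close> preserves regularity, any regular element of \<open>L\<close> serves as \<open>c\<close>. Given
  \<open>c\<close>, the image of \<open>\<sigma>\<^sup>n\<close> contains the left ideal generated by the regular element
  \<open>c \<sigma>(c) \<dots> \<sigma>\<^sup>n\<^sup>-\<^sup>1(c)\<close>, which is essential. Finally the kernels of the powers of
  \<open>\<sigma>\<close> stabilise, at \<open>N\<close> say. Then the image of \<open>\<sigma>\<^sup>N\<close> meets the kernel of \<open>\<sigma>\<close> trivially, and if
  it contains an essential left ideal, that kernel must be zero.
\<close>

section \<open>Left ideals and essentiality, elementwise\<close>

context ring
begin

lemma minus_zero_imp_eq: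
  assumes "a \<in> carrier R" "b \<in> carrier R" "a \<ominus> b = \<zero>"
  shows "a = b"
  using assms minus_equality[of a "\<ominus> b"] by (simp add: a_minus_def)

lemma left_idealI:
  assumes "I \<subseteq> carrier R" "\<zero> \<in> I"
    and add: "\<And>a b. \<lbrakk>a \<in> I; b \<in> I\<rbrakk> \<Longrightarrow> a \<oplus> b \<in> I"
    and mult: "\<And>r a. \<lbrakk>r \<in> carrier R; a \<in> I\<rbrakk> \<Longrightarrow> r \<otimes> a \<in> I"
  shows "left_ideal I R"
proof -
  have "\<ominus> a \<in> I" if "a \<in> I" for a
    using mult[of "\<ominus> \<one>" a] that assms(1) l_minus[of \<one> a] by auto
  then have "subgroup I (add_monoid R)"
    using assms by (intro add.subgroupI) (auto simp: a_inv_def)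
  then show ?thesis
    unfolding left_ideal_def additive_subgroup_def using mult by auto
qed

lemma
  assumes "left_ideal I R"
  shows left_ideal_subset: "I \<subseteq> carrier R"
    and left_ideal_zero: "\<zero> \<in> I"
    and left_ideal_add: "\<lbrakk>a \<in> I; b \<in> I\<rbrakk> \<Longrightarrow> a \<oplus> b \<in> I"
    and left_ideal_mult: "\<lbrakk>r \<in> carrier R; a \<in> I\<rbrakk> \<Longrightarrow> r \<otimes> a \<in> I"
proof -
  interpret additive_subgroup I R
    using assms unfolding left_ideal_def by blast
  show "I \<subseteq> carrier R" "\<zero> \<in> I" "\<lbrakk>a \<in> I; b \<in> I\<rbrakk> \<Longrightarrow> a \<oplus> b \<in> I"
    using a_subset by auto
  show "\<lbrakk>r \<in> carrier R; a \<in> I\<rbrakk> \<Longrightarrow> r \<otimes> a \<in> I"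
    using assms unfolding left_ideal_def by blast
qed

lemma left_ideal_principal:
  assumes "c \<in> carrier R"
  shows "left_ideal {r \<otimes> c |r. r \<in> carrier R} R"
proof (rule left_idealI)
  have "\<zero> = \<zero> \<otimes> c"
    using assms by simp
  then show "\<zero> \<in> {r \<otimes> c |r. r \<in> carrier R}"
    by blast
next
  fix a b assume "a \<in> {r \<otimes> c |r. r \<in> carrier R}" "b \<in> {r \<otimes> c |r. r \<in> carrier R}"
  then show "a \<oplus> b \<in> {r \<otimes> c |r. r \<in> carrier R}"
    using assms by (auto simp: l_distr[symmetric])
next
  fix r a assume "r \<in> carrier R" "a \<in> {r \<otimes> c |r. r \<in> carrier R}"
  then show "r \<otimes> a \<in> {r \<otimes> c |r. r \<in> carrier R}"
    using assms by (auto simp: m_assoc[symmetric])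
qed (use assms in auto)

lemma left_ideal_add_mult:
  assumes J: "left_ideal J R" and I: "left_ideal I R" and d: "d \<in> carrier R"
  shows "left_ideal {j \<oplus> i \<otimes> d |j i. j \<in> J \<and> i \<in> I} R"
proof -
  note sub = subsetD[OF left_ideal_subset[OF J]] subsetD[OF left_ideal_subset[OF I]]
  show ?thesis
  proof (rule left_idealI)
    show "{j \<oplus> i \<otimes> d |j i. j \<in> J \<and> i \<in> I} \<subseteq> carrier R"
      using sub d by auto
    have "\<zero> = \<zero> \<oplus> \<zero> \<otimes> d"
      using d by simp
    then show "\<zero> \<in> {j \<oplus> i \<otimes> d |j i. j \<in> J \<and> i \<in> I}"
      using left_ideal_zero[OF J] left_ideal_zero[OF I] by blast
  next
    fix a b
    assume "a \<in> {j \<oplus> i \<otimes> d |j i. j \<in> J \<and> i \<in> I}" "b \<in> {j \<oplus> i \<otimes> d |j i. j \<in> J \<and> i \<in> I}"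
    then obtain j i j' i' where *: "a = j \<oplus> i \<otimes> d" "b = j' \<oplus> i' \<otimes> d"
      "j \<in> J" "i \<in> I" "j' \<in> J" "i' \<in> I"
      by blast
    then have "a \<oplus> b = (j \<oplus> j') \<oplus> (i \<oplus> i') \<otimes> d"
      using d sub by (simp add: l_distr a_ac)
    then show "a \<oplus> b \<in> {j \<oplus> i \<otimes> d |j i. j \<in> J \<and> i \<in> I}"
      using * left_ideal_add[OF J] left_ideal_add[OF I] by blast
  next
    fix r a assume r: "r \<in> carrier R" and "a \<in> {j \<oplus> i \<otimes> d |j i. j \<in> J \<and> i \<in> I}"
    then obtain j i where *: "a = j \<oplus> i \<otimes> d" "j \<in> J" "i \<in> I"
      by blast
    then have "r \<otimes> a = r \<otimes> j \<oplus> (r \<otimes> i) \<otimes> d"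
      using d r sub by (simp add: r_distr m_assoc)
    then show "r \<otimes> a \<in> {j \<oplus> i \<otimes> d |j i. j \<in> J \<and> i \<in> I}"
      using * left_ideal_mult[OF J r] left_ideal_mult[OF I r] by blast
  qed
qed

text \<open>A nonzero left ideal contains a nonzero principal one, so essentiality needs to be tested
  only on the left ideals \<open>R x\<close>.\<close>

lemma essential_left_ideal_iff:
  "essential_left_ideal L R \<longleftrightarrow> left_ideal L R \<and>
     (\<forall>x\<in>carrier R. x \<noteq> \<zero> \<longrightarrow> (\<exists>r\<in>carrier R. r \<otimes> x \<in> L \<and> r \<otimes> x \<noteq> \<zero>))"
proof (intro iffI conjI ballI impI)
  fix x assume L: "essential_left_ideal L R" and x: "x \<in> carrier R" "x \<noteq> \<zero>"
  let ?P = "{r \<otimes> x |r. r \<in> carrier R}"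
  have P: "left_ideal ?P R"
    using x by (simp add: left_ideal_principal)
  have "\<one> \<otimes> x \<in> ?P"
    by blast
  then have "?P \<noteq> {\<zero>}"
    using x by auto
  then have "L \<inter> ?P \<noteq> {\<zero>}"
    using L P unfolding essential_left_ideal_def by blast
  moreover have "\<zero> \<in> L \<inter> ?P"
    using L left_ideal_zero[OF P] left_ideal_zero[of L] unfolding essential_left_ideal_def by blast
  ultimately show "\<exists>r\<in>carrier R. r \<otimes> x \<in> L \<and> r \<otimes> x \<noteq> \<zero>"
    by blast
next
  assume *: "left_ideal L R \<and>
     (\<forall>x\<in>carrier R. x \<noteq> \<zero> \<longrightarrow> (\<exists>r\<in>carrier R. r \<otimes> x \<in> L \<and> r \<otimes> x \<noteq> \<zero>))"
  show "essential_left_ideal L R"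
    unfolding essential_left_ideal_def
  proof (intro conjI allI impI)
    fix I assume I: "left_ideal I R \<and> I \<noteq> {\<zero>}"
    then obtain x where x: "x \<in> I" "x \<noteq> \<zero>"
      using left_ideal_zero by blast
    then obtain r where "r \<in> carrier R" "r \<otimes> x \<in> L" "r \<otimes> x \<noteq> \<zero>"
      using * I left_ideal_subset by blast
    then show "L \<inter> I \<noteq> {\<zero>}"
      using I x left_ideal_mult by blast
  qed (use * in blast)
qed (auto simp: essential_left_ideal_def)

lemma left_noetherian_has_maximal:
  assumes noeth: "left_noetherian R"
    and "F \<noteq> {}" and left: "\<forall>I\<in>F. left_ideal I R"
  shows "\<exists>M\<in>F. \<forall>I\<in>F. M \<subseteq> I \<longrightarrow> I = M"
proof (rule ccontr)
  assume no_max: "\<not> ?thesis"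
  have "\<exists>f. \<forall>n::nat. f n \<in> F \<and> f n \<subset> f (Suc n)"
    by (rule dependent_nat_choice) (use no_max \<open>F \<noteq> {}\<close> in \<open>blast+\<close>)
  then obtain f where f: "f n \<in> F" "f n \<subset> f (Suc n)" for n :: nat
    by blast
  then have "(\<forall>n. left_ideal (f n) R) \<and> (\<forall>n. f n \<subseteq> f (Suc n))"
    using left by blast
  then obtain N where "\<forall>n\<ge>N. f n = f N"
    using noeth unfolding left_noetherian_def by blast
  then have "f (Suc N) = f N"
    using le_SucI[OF le_refl] by blast
  then show False
    using f(2)[of N] by simp
qed

section \<open>Left annihilators of elements\<close>

definition lann :: "'a \<Rightarrow> 'a set" where
  "lann a = {r \<in> carrier R. r \<otimes> a = \<zero>}"

lemma left_ideal_lann: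
  assumes "a \<in> carrier R"
  shows "left_ideal (lann a) R"
  by (rule left_idealI) (use assms in \<open>auto simp: lann_def l_distr m_assoc\<close>)

lemma lann_subset_lann_mult:
  assumes "a \<in> carrier R" "b \<in> carrier R"
  shows "lann a \<subseteq> lann (a \<otimes> b)"
  using assms by (auto simp: lann_def m_assoc[symmetric])

text \<open>If a nonzero left ideal \<open>I\<close> met \<open>R c\<close> trivially, the sum \<open>I + I c + I c\<^sup>2 + \<dots>\<close> would be direct and so violate
  the chain condition. In terms of maximal elements: a left ideal \<open>J\<close> maximal among those that
  meet some \<open>R c\<^sup>n\<close> trivially absorbs \<open>I c\<^sup>n\<close>, because \<open>J + I c\<^sup>n\<close> meets \<open>R c\<^sup>n\<^sup>+\<^sup>1\<close> trivially.\<close>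

lemma essential_principal_if_lann_zero:
  assumes noeth: "left_noetherian R" and c: "c \<in> carrier R" and lann: "lann c = {\<zero>}"
  shows "essential_left_ideal {r \<otimes> c |r. r \<in> carrier R} R"
  unfolding essential_left_ideal_iff
proof (intro conjI ballI impI left_ideal_principal c, rule ccontr)
  have cancel: "r = \<zero>" if "r \<in> carrier R" "r \<otimes> c = \<zero>" for r
    using lann that unfolding lann_def by blast
  have cancel_pow: "r = \<zero>" if "r \<in> carrier R" "r \<otimes> c [^] n = \<zero>" for r and n :: nat
    using that
  proof (induction n arbitrary: r)
    case (Suc n)
    then have "(r \<otimes> c [^] n) \<otimes> c = \<zero>"
      using c by (simp add: m_assoc)
    then have "r \<otimes> c [^] n = \<zero>"
      using cancel[of "r \<otimes> c [^] n"] Suc.prems(1) c by simp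
    then show ?case
      using Suc.IH Suc.prems(1) by blast
  qed simp
  fix x assume x: "x \<in> carrier R" "x \<noteq> \<zero>"
    and "\<not> (\<exists>r\<in>carrier R. r \<otimes> x \<in> {r \<otimes> c |r. r \<in> carrier R} \<and> r \<otimes> x \<noteq> \<zero>)"
  then have disj: "r \<otimes> x = \<zero>" if "r \<in> carrier R" "s \<in> carrier R" "r \<otimes> x = s \<otimes> c" for r s
    using that by blast
  define F where "F = {J. left_ideal J R \<and>
    (\<exists>n::nat. \<forall>r\<in>carrier R. r \<otimes> c [^] n \<in> J \<longrightarrow> r \<otimes> c [^] n = \<zero>)}"
  have "{\<zero>} \<in> F"
    unfolding F_def by (auto intro: left_idealI)
  have F_left: "\<forall>I\<in>F. left_ideal I R"
    unfolding F_def by blast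
  obtain J where J: "J \<in> F" and J_max: "\<And>I. \<lbrakk>I \<in> F; J \<subseteq> I\<rbrakk> \<Longrightarrow> I = J"
    using left_noetherian_has_maximal[OF noeth _ F_left] \<open>{\<zero>} \<in> F\<close> by blast
  have J_left: "left_ideal J R"
    using J unfolding F_def by blast
  note J_sub = subsetD[OF left_ideal_subset[OF J_left]]
  obtain n :: nat where n: "\<And>r. \<lbrakk>r \<in> carrier R; r \<otimes> c [^] n \<in> J\<rbrakk> \<Longrightarrow> r \<otimes> c [^] n = \<zero>"
    using J unfolding F_def by blast
  define I where "I = {r \<otimes> x |r. r \<in> carrier R}"
  have I_left: "left_ideal I R"
    unfolding I_def using x by (simp add: left_ideal_principal)
  define J' where "J' = {j \<oplus> i \<otimes> c [^] n |j i. j \<in> J \<and> i \<in> I}"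
  have J'_left: "left_ideal J' R"
    unfolding J'_def using J_left I_left c by (simp add: left_ideal_add_mult)
  have "r \<otimes> c [^] Suc n = \<zero>" if r: "r \<in> carrier R" and rJ: "r \<otimes> c [^] Suc n \<in> J'" for r
  proof -
    obtain j s where j: "j \<in> J" and s: "s \<in> carrier R"
      and eq: "r \<otimes> c [^] Suc n = j \<oplus> (s \<otimes> x) \<otimes> c [^] n"
      using rJ unfolding J'_def I_def by blast
    define y where "y = r \<otimes> c \<ominus> s \<otimes> x"
    have y: "y \<in> carrier R"
      using r s c x unfolding y_def by simp
    have "y \<otimes> c [^] n = r \<otimes> c [^] Suc n \<ominus> (s \<otimes> x) \<otimes> c [^] n"
      unfolding y_def using r s c x nat_pow_Suc2[OF c]
      by (simp add: a_minus_def l_distr l_minus m_assoc del: nat_pow_Suc)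
    also have "\<dots> = j"
      unfolding eq using J_sub[OF j] s x c by (simp add: a_minus_def a_assoc r_neg)
    finally have yj: "y \<otimes> c [^] n = j" .
    then have "j = \<zero>"
      using n[OF y] j by simp
    then have "y = \<zero>"
      using cancel_pow[OF y] yj by simp
    then have "r \<otimes> c = s \<otimes> x"
      unfolding y_def using r s c x minus_zero_imp_eq[of "r \<otimes> c" "s \<otimes> x"] by simp
    then have "s \<otimes> x = r \<otimes> c"
      by (rule sym)
    then have "r \<otimes> c = \<zero>"
      using disj[OF s r] by simp
    then show ?thesis
      using cancel[OF r] c by simp
  qed
  then have "J' \<in> F"
    unfolding F_def using J'_left by blast
  moreover have "J \<subseteq> J'"
  proof
    fix j assume j: "j \<in> J"
    then have "j = j \<oplus> \<zero> \<otimes> c [^] n"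
      using J_sub c by simp
    then show "j \<in> J'"
      unfolding J'_def using j left_ideal_zero[OF I_left] by blast
  qed
  ultimately have "J' = J"
    by (rule J_max)
  moreover have "x \<otimes> c [^] n \<in> J'"
  proof -
    have "x \<otimes> c [^] n = \<zero> \<oplus> (\<one> \<otimes> x) \<otimes> c [^] n"
      using x c by simp
    then show ?thesis
      unfolding J'_def I_def using left_ideal_zero[OF J_left] by blast
  qed
  ultimately have "x \<otimes> c [^] n = \<zero>"
    using n[OF x(1)] by simp
  then show False
    using cancel_pow x by blast
qed

section \<open>Semiprime left noetherian rings\<close>

text \<open>Semiprimeness for elements. The set of all \<open>x\<close> with \<open>x R a = 0\<close> is a two-sided ideal \<open>T\<close>;
  intersecting it with its own right annihilator gives an ideal of square zero which still
  contains \<open>a\<close>. This avoids describing the ideal generated by \<open>a\<close>.\<close>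

lemma semiprime_element_zero:
  assumes semi: "semiprime_ring R" and a: "a \<in> carrier R"
    and aRa: "\<And>r. r \<in> carrier R \<Longrightarrow> (a \<otimes> r) \<otimes> a = \<zero>"
  shows "a = \<zero>"
proof -
  define T where "T = {x \<in> carrier R. \<forall>r\<in>carrier R. (x \<otimes> r) \<otimes> a = \<zero>}"
  define I where "I = {x \<in> T. \<forall>t\<in>T. t \<otimes> x = \<zero>}"
  have T_add: "x \<oplus> y \<in> T" if "x \<in> T" "y \<in> T" for x y
    using that a unfolding T_def by (auto simp: l_distr)
  have T_l: "r \<otimes> x \<in> T" if "x \<in> T" "r \<in> carrier R" for x r
    using that a unfolding T_def by (auto simp: m_assoc)
  have T_r: "x \<otimes> r \<in> T" if "x \<in> T" "r \<in> carrier R" for x r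
  proof -
    have "((x \<otimes> r) \<otimes> s) \<otimes> a = (x \<otimes> (r \<otimes> s)) \<otimes> a" if "s \<in> carrier R" for s
      using that \<open>x \<in> T\<close> \<open>r \<in> carrier R\<close> unfolding T_def by (simp add: m_assoc)
    then show ?thesis
      using that unfolding T_def by simp
  qed
  have T_sub: "x \<in> carrier R" if "x \<in> T" for x
    using that unfolding T_def by blast
  have "left_ideal I R"
  proof (rule left_idealI)
    fix x y assume "x \<in> I" "y \<in> I"
    then show "x \<oplus> y \<in> I"
      unfolding I_def using T_add T_sub by (auto simp: r_distr)
  next
    fix r x assume "r \<in> carrier R" "x \<in> I"
    then show "r \<otimes> x \<in> I"
      unfolding I_def using T_l T_r T_sub by (auto simp: m_assoc[symmetric])
  next
    have "\<zero> \<in> T"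
      using a unfolding T_def by simp
    then show "\<zero> \<in> I"
      unfolding I_def using T_sub by simp
  qed (auto simp: I_def T_def)
  have I: "ideal I R"
  proof (intro idealI ring_axioms)
    show "subgroup I (add_monoid R)" "\<And>x r. \<lbrakk>x \<in> I; r \<in> carrier R\<rbrakk> \<Longrightarrow> r \<otimes> x \<in> I"
      using \<open>left_ideal I R\<close> unfolding left_ideal_def additive_subgroup_def by auto
    fix x r assume "x \<in> I" "r \<in> carrier R"
    then show "x \<otimes> r \<in> I"
      unfolding I_def using T_r T_sub by (auto simp: m_assoc[symmetric])
  qed
  have "z = \<zero>" if "z \<in> I \<cdot> I" for z
    using that by induction (auto simp: I_def)
  moreover have "\<zero> \<in> I \<cdot> I"
  proof -
    have "\<zero> \<in> I"
      using I by (simp add: additive_subgroup.zero_closed ideal.axioms(1))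
    then show ?thesis
      using ideal_prod.prod[of \<zero> I \<zero> I R] by simp
  qed
  ultimately have "I \<cdot> I = {\<zero>}"
    by blast
  then have "I = {\<zero>}"
    using semi I unfolding semiprime_ring_def by blast
  moreover have "a \<in> I"
    using a aRa unfolding I_def T_def by (auto dest: bspec[where x = \<one>])
  ultimately show ?thesis
    by blast
qed

text \<open>The left singular ideal vanishes. Let \<open>a \<noteq> 0\<close> be singular with largest possible left
  annihilator. For singular \<open>b\<close>, some nonzero \<open>r a\<close> lies in the essential left ideal
  \<open>lann b\<close>, so \<open>a b\<close> has a strictly larger left annihilator than \<open>a\<close> and must be \<open>0\<close>. As all
  multiples \<open>r a\<close> are singular, \<open>a R a = 0\<close>.\<close>

lemma nonsingular:
  assumes semi: "semiprime_ring R" and noeth: "left_noetherian R"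
    and b: "b \<in> carrier R" and ess: "essential_left_ideal (lann b) R"
  shows "b = \<zero>"
proof (rule ccontr)
  assume "b \<noteq> \<zero>"
  define Z where "Z = {a \<in> carrier R. essential_left_ideal (lann a) R}"
  define F where "F = {lann a |a. a \<in> Z \<and> a \<noteq> \<zero>}"
  have "lann b \<in> F"
    unfolding F_def Z_def using b ess \<open>b \<noteq> \<zero>\<close> by blast
  have F_left: "\<forall>I\<in>F. left_ideal I R"
    using left_ideal_lann unfolding F_def Z_def by blast
  obtain M where "M \<in> F" and M_max: "\<And>I. \<lbrakk>I \<in> F; M \<subseteq> I\<rbrakk> \<Longrightarrow> I = M"
    using left_noetherian_has_maximal[OF noeth _ F_left] \<open>lann b \<in> F\<close> by blast
  then obtain a where a: "a \<in> Z" "a \<noteq> \<zero>" "M = lann a"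
    unfolding F_def by blast
  then have aR: "a \<in> carrier R"
    unfolding Z_def by blast
  have Z_l: "r \<otimes> a \<in> Z" if r: "r \<in> carrier R" for r
  proof -
    have "\<exists>s\<in>carrier R. s \<otimes> x \<in> lann (r \<otimes> a) \<and> s \<otimes> x \<noteq> \<zero>"
      if x: "x \<in> carrier R" "x \<noteq> \<zero>" for x
    proof (cases "x \<otimes> r = \<zero>")
      case True
      then have "\<one> \<otimes> x \<in> lann (r \<otimes> a)"
        using x r aR unfolding lann_def by (simp add: m_assoc[symmetric])
      moreover have "\<one> \<otimes> x \<noteq> \<zero>"
        using x by simp
      ultimately show ?thesis
        by blast
    next
      case False
      then obtain s where s: "s \<in> carrier R" "s \<otimes> (x \<otimes> r) \<in> lann a" "s \<otimes> (x \<otimes> r) \<noteq> \<zero>"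
        using a(1) x r unfolding Z_def essential_left_ideal_iff by blast
      then have "s \<otimes> x \<in> lann (r \<otimes> a)" "s \<otimes> x \<noteq> \<zero>"
        using x r aR unfolding lann_def by (auto simp: m_assoc) (simp add: m_assoc[symmetric])
      then show ?thesis
        using s by blast
    qed
    then show ?thesis
      unfolding Z_def essential_left_ideal_iff using r aR by (simp add: left_ideal_lann)
  qed
  have aZ: "a \<otimes> b = \<zero>" if b: "b \<in> Z" for b
  proof (rule ccontr)
    assume ab: "a \<otimes> b \<noteq> \<zero>"
    have bR: "b \<in> carrier R"
      using b unfolding Z_def by blast
    have mono: "lann a \<subseteq> lann (a \<otimes> b)"
      using aR bR by (rule lann_subset_lann_mult)
    then have "a \<otimes> b \<in> Z"
      using a(1) aR bR unfolding Z_def essential_left_ideal_iff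
      by (auto simp: left_ideal_lann) (meson subsetD)
    then have "lann (a \<otimes> b) = lann a"
      using M_max[of "lann (a \<otimes> b)"] mono ab a(3) unfolding F_def by blast
    moreover obtain r where "r \<in> carrier R" "r \<otimes> a \<in> lann b" "r \<otimes> a \<noteq> \<zero>"
      using b aR a(2) unfolding Z_def essential_left_ideal_iff by blast
    then have "r \<in> lann (a \<otimes> b)" "r \<notin> lann a"
      using aR bR unfolding lann_def by (auto simp: m_assoc)
    ultimately show False
      by blast
  qed
  have "a = \<zero>"
    by (rule semiprime_element_zero[OF semi aR]) (use aZ Z_l aR in \<open>simp add: m_assoc\<close>)
  then show False
    using a(2) by blast
qed

text \<open>One-sided regularity suffices: \<open>c b = 0\<close> means that \<open>lann b\<close> contains the essential left
  ideal \<open>R c\<close>, so that \<open>b\<close> is singular.\<close>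

lemma regular_if_lann_zero:
  assumes semi: "semiprime_ring R" and noeth: "left_noetherian R"
    and c: "c \<in> carrier R" and lann: "lann c = {\<zero>}"
  shows "c \<in> regular_elements R"
proof -
  have "b = \<zero>" if b: "b \<in> carrier R" "c \<otimes> b = \<zero>" for b
  proof -
    have "{r \<otimes> c |r. r \<in> carrier R} \<subseteq> lann b"
      using b c unfolding lann_def by (auto simp: m_assoc)
    then have "essential_left_ideal (lann b) R"
      using essential_principal_if_lann_zero[OF noeth c lann] b(1) left_ideal_lann
      unfolding essential_left_ideal_iff by (meson subsetD)
    then show ?thesis
      using nonsingular[OF semi noeth b(1)] by blast
  qed
  moreover have "b = \<zero>" if "b \<in> carrier R" "b \<otimes> c = \<zero>" for b
    using lann that unfolding lann_def by blast
  ultimately show ?thesis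
    unfolding regular_elements_def using c by blast
qed

lemma
  assumes "c \<in> regular_elements R"
  shows regular_carrier: "c \<in> carrier R"
    and regular_left: "\<lbrakk>b \<in> carrier R; c \<otimes> b = \<zero>\<rbrakk> \<Longrightarrow> b = \<zero>"
    and regular_right: "\<lbrakk>b \<in> carrier R; b \<otimes> c = \<zero>\<rbrakk> \<Longrightarrow> b = \<zero>"
  using assms unfolding regular_elements_def by blast+

lemma lann_regular:
  assumes "c \<in> regular_elements R"
  shows "lann c = {\<zero>}"
  using assms unfolding regular_elements_def lann_def by auto

text \<open>Nonzero left ideals are not nil. Otherwise take \<open>a \<noteq> 0\<close> with \<open>R a\<close> nil and largest
  left annihilator. For \<open>r\<close> in \<open>R\<close> the element \<open>a r\<close> is nilpotent; its last nonzero power has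
  the form \<open>a s\<close>, hence by maximality the same left annihilator as \<open>a\<close>, and \<open>a r\<close> belongs to
  it. Thus \<open>a R a = 0\<close>.\<close>

lemma nil_left_ideal_zero:
  assumes semi: "semiprime_ring R" and noeth: "left_noetherian R"
    and J: "left_ideal J R" and nil: "\<And>x. x \<in> J \<Longrightarrow> \<exists>n::nat. x [^] n = \<zero>"
    and b: "b \<in> J"
  shows "b = \<zero>"
proof (rule ccontr)
  assume "b \<noteq> \<zero>"
  define S where "S = {a \<in> carrier R. \<forall>r\<in>carrier R. \<exists>n::nat. (r \<otimes> a) [^] n = \<zero>}"
  define F where "F = {lann a |a. a \<in> S \<and> a \<noteq> \<zero>}"
  have pow_swap: "(x \<otimes> y) [^] Suc n = (x \<otimes> (y \<otimes> x) [^] n) \<otimes> y"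
    if "x \<in> carrier R" "y \<in> carrier R" for x y and n :: nat
  proof (induction n)
    case (Suc n)
    have "(x \<otimes> y) [^] Suc (Suc n) = (x \<otimes> (y \<otimes> x) [^] n) \<otimes> y \<otimes> (x \<otimes> y)"
      using Suc by simp
    then show ?case
      using that by (simp add: m_assoc)
  qed (use that in simp)
  have nil_swap: "\<exists>n::nat. (y \<otimes> x) [^] n = \<zero>"
    if "x \<in> carrier R" "y \<in> carrier R" "(x \<otimes> y) [^] n = \<zero>" for x y and n :: nat
    using that pow_swap[of y x n] by (intro exI[of _ "Suc n"]) simp
  have "b \<in> S"
    unfolding S_def using b left_ideal_subset[OF J] left_ideal_mult[OF J] nil by blast
  then have "lann b \<in> F"
    unfolding F_def using \<open>b \<noteq> \<zero>\<close> by blast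
  have F_left: "\<forall>I\<in>F. left_ideal I R"
    using left_ideal_lann unfolding F_def S_def by blast
  obtain M where "M \<in> F" and M_max: "\<And>I. \<lbrakk>I \<in> F; M \<subseteq> I\<rbrakk> \<Longrightarrow> I = M"
    using left_noetherian_has_maximal[OF noeth _ F_left] \<open>lann b \<in> F\<close> by blast
  then obtain a where a: "a \<in> S" "a \<noteq> \<zero>" "M = lann a"
    unfolding F_def by blast
  then have aR: "a \<in> carrier R"
    unfolding S_def by blast
  have S_r: "a \<otimes> s \<in> S" if s: "s \<in> carrier R" for s
  proof -
    have "\<exists>n::nat. (r \<otimes> (a \<otimes> s)) [^] n = \<zero>" if r: "r \<in> carrier R" for r
    proof -
      obtain n :: nat where "((s \<otimes> r) \<otimes> a) [^] n = \<zero>"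
        using a(1) s r unfolding S_def by blast
      then have "(s \<otimes> (r \<otimes> a)) [^] n = \<zero>"
        using s r aR by (simp add: m_assoc)
      then show ?thesis
        using nil_swap[of s "r \<otimes> a" n] s r aR by (simp add: m_assoc)
    qed
    then show ?thesis
      unfolding S_def using aR s by blast
  qed
  have "(a \<otimes> r) \<otimes> a = \<zero>" if r: "r \<in> carrier R" for r
  proof (cases "a \<otimes> r = \<zero>")
    case True
    then show ?thesis
      using aR by simp
  next
    case False
    define n where "n = (LEAST n::nat. (a \<otimes> r) [^] n = \<zero>)"
    obtain m :: nat where "(r \<otimes> a) [^] m = \<zero>"
      using a(1) r unfolding S_def by blast
    then have "\<exists>n::nat. (a \<otimes> r) [^] n = \<zero>"
      using nil_swap r aR by blast
    then have n: "(a \<otimes> r) [^] n = \<zero>"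
      unfolding n_def by (rule LeastI_ex)
    have n_least: "(a \<otimes> r) [^] k \<noteq> \<zero>" if "k < n" for k
      using that not_less_Least unfolding n_def by blast
    have "\<one> \<noteq> \<zero>"
      using False aR r by (metis l_null l_one m_closed)
    \<comment> \<open>As \<open>1\<close> and \<open>a r\<close> are nonzero, \<open>n \<ge> 2\<close>; so the last nonzero power is a multiple of \<open>a\<close>.\<close>
    then obtain k where k: "n = Suc (Suc k)"
      using n False aR r
      by (metis (no_types, lifting) l_one m_closed nat_pow_0 nat_pow_Suc not0_implies_Suc)
    define s where "s = r \<otimes> (a \<otimes> r) [^] k"
    have sR: "s \<in> carrier R"
      unfolding s_def using r aR by simp
    have as: "a \<otimes> s = (a \<otimes> r) [^] Suc k"
      unfolding s_def nat_pow_Suc2[OF m_closed[OF aR r]] using r aR by (simp add: m_assoc)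
    have "a \<otimes> s \<noteq> \<zero>"
      using n_least[of "Suc k"] k as by simp
    then have "lann (a \<otimes> s) = lann a"
      using M_max[of "lann (a \<otimes> s)"] lann_subset_lann_mult[OF aR sR] S_r[OF sR] a(3)
      unfolding F_def by blast
    moreover have "a \<otimes> r \<in> lann (a \<otimes> s)"
      unfolding lann_def as using n k aR r nat_pow_Suc2[of "a \<otimes> r" "Suc k"] by simp
    ultimately show ?thesis
      unfolding lann_def by blast
  qed
  then have "a = \<zero>"
    using semiprime_element_zero[OF semi aR] by blast
  then show False
    using a(2) by blast
qed

text \<open>Powers of a non-nilpotent element have increasing left annihilators; a power beyond
  which they are constant has the desired property. In the proof of Goldie's theorem such elements
  \<open>a\<close> allow cancellation in \<open>r a a = 0\<close>, so that \<open>R a\<close> meets \<open>lann a\<close> trivially.\<close>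

lemma left_ideal_contains_lann_square:
  assumes semi: "semiprime_ring R" and noeth: "left_noetherian R"
    and J: "left_ideal J R" and "J \<noteq> {\<zero>}"
  obtains a where "a \<in> J" "a \<noteq> \<zero>" "lann (a \<otimes> a) = lann a"
proof -
  obtain x where x: "x \<in> J" "\<And>n::nat. x [^] n \<noteq> \<zero>"
    using nil_left_ideal_zero[OF semi noeth J] left_ideal_zero[OF J] \<open>J \<noteq> {\<zero>}\<close> by blast
  then have xR: "x \<in> carrier R"
    using left_ideal_subset[OF J] by blast
  define F where "F = range (\<lambda>n::nat. lann (x [^] Suc n))"
  have F_left: "\<forall>I\<in>F. left_ideal I R"
    using left_ideal_lann nat_pow_closed[OF xR] unfolding F_def by blast
  have "F \<noteq> {}"
    unfolding F_def by blast
  then obtain M where "M \<in> F" and M_max: "\<And>I. \<lbrakk>I \<in> F; M \<subseteq> I\<rbrakk> \<Longrightarrow> I = M"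
    using left_noetherian_has_maximal[OF noeth _ F_left] by blast
  then obtain n :: nat where n: "M = lann (x [^] Suc n)"
    unfolding F_def by blast
  define a where "a = x [^] Suc n"
  have "a \<in> J"
    unfolding a_def using left_ideal_mult[OF J nat_pow_closed[OF xR] x(1)] by simp
  moreover have "a \<noteq> \<zero>"
    unfolding a_def using x(2) by blast
  moreover have "lann (a \<otimes> a) = lann a"
  proof -
    have "a \<otimes> a = x [^] Suc (n + Suc n)"
      unfolding a_def using nat_pow_mult[OF xR, of "Suc n" "Suc n"] by simp
    then have "lann (a \<otimes> a) \<in> F"
      unfolding F_def by (metis rangeI)
    then show ?thesis
      using M_max n lann_subset_lann_mult[of a a] xR unfolding a_def by simp
  qed
  ultimately show thesis
    by (rule that)
qed

text \<open>Goldie's theorem on essential left ideals. Among the elements \<open>c\<close> of \<open>L\<close> with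
  \<open>lann (c c) = lann c\<close>, choose one together with a largest possible left ideal \<open>I\<close> meeting
  \<open>lann c\<close> trivially. If \<open>lann c \<noteq> 0\<close>, essentiality provides an element \<open>a \<noteq> 0\<close> of the same kind
  in \<open>L \<inter> lann c\<close>. Since \<open>a c = 0\<close>, one gets \<open>lann (c + a) = lann c \<inter> lann a\<close>, and
  the pair \<open>c + a\<close>, \<open>I + R a\<close> contradicts the choice of \<open>I\<close>.\<close>

theorem essential_left_ideal_contains_regular:
  assumes semi: "semiprime_ring R" and noeth: "left_noetherian R"
    and L: "essential_left_ideal L R"
  obtains c where "c \<in> L" "c \<in> regular_elements R"
proof -
  have L_left: "left_ideal L R"
    using L unfolding essential_left_ideal_def by blast
  define F where "F = {I. left_ideal I R \<and>
    (\<exists>c\<in>L. lann (c \<otimes> c) = lann c \<and> I \<inter> lann c \<subseteq> {\<zero>})}"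
  have "{\<zero>} \<in> F"
    unfolding F_def using left_ideal_zero[OF L_left] by (auto intro!: left_idealI bexI[of _ \<zero>])
  have F_left: "\<forall>I\<in>F. left_ideal I R"
    unfolding F_def by blast
  obtain I where "I \<in> F" and I_max: "\<And>I'. \<lbrakk>I' \<in> F; I \<subseteq> I'\<rbrakk> \<Longrightarrow> I' = I"
    using left_noetherian_has_maximal[OF noeth _ F_left] \<open>{\<zero>} \<in> F\<close> by blast
  then obtain c where I_left: "left_ideal I R" and c: "c \<in> L" "lann (c \<otimes> c) = lann c"
    and Ic: "I \<inter> lann c \<subseteq> {\<zero>}"
    unfolding F_def by blast
  have cR: "c \<in> carrier R"
    using c left_ideal_subset[OF L_left] by blast
  have c_cancel: "r \<otimes> c = \<zero>" if "r \<in> carrier R" "(r \<otimes> c) \<otimes> c = \<zero>" for r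
  proof -
    have "r \<in> lann (c \<otimes> c)"
      using that cR unfolding lann_def by (simp add: m_assoc)
    then have "r \<in> lann c"
      using c(2) by simp
    then show ?thesis
      unfolding lann_def by blast
  qed
  have "lann c = {\<zero>}"
  proof (rule ccontr)
    assume "lann c \<noteq> {\<zero>}"
    then have "L \<inter> lann c \<noteq> {\<zero>}"
      using L left_ideal_lann[OF cR] unfolding essential_left_ideal_def by blast
    moreover have "left_ideal (L \<inter> lann c) R"
      using L_left left_ideal_lann[OF cR]
      by (auto intro!: left_idealI simp: left_ideal_zero left_ideal_add left_ideal_mult
          dest: subsetD[OF left_ideal_subset])
    ultimately obtain a where a: "a \<in> L" "a \<in> lann c" "a \<noteq> \<zero>" "lann (a \<otimes> a) = lann a"
      using left_ideal_contains_lann_square[OF semi noeth] by blast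
    have aR: "a \<in> carrier R" and ac: "a \<otimes> c = \<zero>"
      using a(2) unfolding lann_def by auto
    have a_cancel: "r \<otimes> a = \<zero>" if "r \<in> carrier R" "(r \<otimes> a) \<otimes> a = \<zero>" for r
    proof -
      have "r \<in> lann (a \<otimes> a)"
        using that aR unfolding lann_def by (simp add: m_assoc)
      then have "r \<in> lann a"
        using a(4) by simp
      then show ?thesis
        unfolding lann_def by blast
    qed
    have rac: "(r \<otimes> a) \<otimes> c = \<zero>" if "r \<in> carrier R" for r
      using that aR cR ac by (simp add: m_assoc)
    have lann_sum: "r \<otimes> c = \<zero> \<and> r \<otimes> a = \<zero>"
      if r: "r \<in> carrier R" "r \<otimes> (c \<oplus> a) = \<zero>" for r
    proof -
      have "((r \<otimes> c) \<oplus> (r \<otimes> a)) \<otimes> c = \<zero>"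
        using r aR cR by (simp add: r_distr)
      then have "(r \<otimes> c) \<otimes> c = \<zero>"
        using r aR cR rac[OF r(1)] by (simp add: l_distr)
      then have "r \<otimes> c = \<zero>"
        using c_cancel r by blast
      then show ?thesis
        using r aR cR by (simp add: r_distr)
    qed
    define I' where "I' = {i \<oplus> r \<otimes> a |i r. i \<in> I \<and> r \<in> carrier R}"
    have "left_ideal (carrier R) R"
      by (rule left_idealI) auto
    then have I'_left: "left_ideal I' R"
      unfolding I'_def using I_left aR left_ideal_add_mult by blast
    have "c \<oplus> a \<in> L"
      using left_ideal_add[OF L_left] a c by blast
    moreover have "lann ((c \<oplus> a) \<otimes> (c \<oplus> a)) = lann (c \<oplus> a)"
    proof
      show "lann ((c \<oplus> a) \<otimes> (c \<oplus> a)) \<subseteq> lann (c \<oplus> a)"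
      proof
        fix r assume "r \<in> lann ((c \<oplus> a) \<otimes> (c \<oplus> a))"
        then have r: "r \<in> carrier R" and "(r \<otimes> (c \<oplus> a)) \<otimes> (c \<oplus> a) = \<zero>"
          using aR cR unfolding lann_def by (auto simp: m_assoc)
        then have *: "(r \<otimes> (c \<oplus> a)) \<otimes> c = \<zero>" "(r \<otimes> (c \<oplus> a)) \<otimes> a = \<zero>"
          using lann_sum[of "r \<otimes> (c \<oplus> a)"] aR cR by auto
        have "(r \<otimes> c) \<otimes> c = \<zero>"
          using *(1) r aR cR rac by (simp add: r_distr l_distr)
        then have rc: "r \<otimes> c = \<zero>"
          using c_cancel r by blast
        then have "(r \<otimes> a) \<otimes> a = \<zero>"
          using *(2) r aR cR by (simp add: r_distr)
        then have "r \<otimes> a = \<zero>"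
          using a_cancel r by blast
        then show "r \<in> lann (c \<oplus> a)"
          unfolding lann_def using rc r aR cR by (simp add: r_distr)
      qed
    qed (use aR cR lann_subset_lann_mult in simp)
    moreover have "I' \<inter> lann (c \<oplus> a) \<subseteq> {\<zero>}"
    proof
      fix z assume z: "z \<in> I' \<inter> lann (c \<oplus> a)"
      then obtain i r where i: "i \<in> I" and r: "r \<in> carrier R" and z_eq: "z = i \<oplus> r \<otimes> a"
        unfolding I'_def by blast
      have iR: "i \<in> carrier R"
        using i left_ideal_subset[OF I_left] by blast
      have za: "z \<otimes> c = \<zero>" "z \<otimes> a = \<zero>"
        using z lann_sum[of z] unfolding lann_def by auto
      have "i \<otimes> c = \<zero>"
        using za(1) rac[OF r] iR r aR cR unfolding z_eq by (simp add: l_distr)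
      then have i0: "i = \<zero>"
        using Ic i iR unfolding lann_def by blast
      then have "r \<otimes> a = \<zero>"
        using za(2) a_cancel[OF r] r aR unfolding z_eq by simp
      then show "z \<in> {\<zero>}"
        unfolding z_eq i0 by simp
    qed
    ultimately have "I' \<in> F"
      unfolding F_def using I'_left by blast
    moreover have "I \<subseteq> I'"
    proof
      fix i assume i: "i \<in> I"
      then have "i = i \<oplus> \<zero> \<otimes> a"
        using left_ideal_subset[OF I_left] aR by auto
      then show "i \<in> I'"
        unfolding I'_def using i by blast
    qed
    ultimately have "I' = I"
      by (rule I_max)
    moreover have "a \<in> I'"
    proof -
      have "a = \<zero> \<oplus> \<one> \<otimes> a"
        using aR by simp
      then show ?thesis
        unfolding I'_def using left_ideal_zero[OF I_left] by blast
    qed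
    ultimately show False
      using Ic a by blast
  qed
  then show thesis
    using that c(1) regular_if_lann_zero[OF semi noeth cR] by blast
qed

section \<open>Endomorphisms with a large image\<close>

lemma ring_endo_funpow:
  assumes "\<sigma> \<in> ring_hom R R"
  shows "\<sigma> ^^ n \<in> ring_hom R R"
proof (induction n)
  case 0
  show ?case
    by (rule ring_hom_memI) auto
next
  case (Suc n)
  then show ?case
    using ring_hom_trans[OF Suc assms] by (simp only: funpow.simps)
qed

lemma ring_endo_inj_iff:
  assumes \<sigma>: "\<sigma> \<in> ring_hom R R"
  shows "inj_on \<sigma> (carrier R) \<longleftrightarrow> (\<forall>x\<in>carrier R. \<sigma> x = \<zero> \<longrightarrow> x = \<zero>)"
proof -
  have zero: "\<sigma> \<zero> = \<zero>"
    using \<sigma> ring_axioms ring_axioms by (rule ring_hom_zero)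
  have "x = y"
    if ker: "\<forall>x\<in>carrier R. \<sigma> x = \<zero> \<longrightarrow> x = \<zero>"
      and xy: "x \<in> carrier R" "y \<in> carrier R" "\<sigma> x = \<sigma> y" for x y
  proof -
    have "\<sigma> (x \<ominus> y) = \<sigma> x \<oplus> \<sigma> (\<ominus> y)"
      using ring_hom_add[OF \<sigma>] xy by (simp add: a_minus_def)
    also have "\<dots> = \<sigma> (y \<oplus> \<ominus> y)"
      using ring_hom_add[OF \<sigma>, of y "\<ominus> y"] xy by simp
    finally have "\<sigma> (x \<ominus> y) = \<zero>"
      using xy zero by (simp add: r_neg)
    then show ?thesis
      using ker xy minus_zero_imp_eq by simp
  qed
  then show ?thesis
    using zero unfolding inj_on_def by (metis zero_closed)
qed

lemma regular_elements_mult: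
  assumes c: "c \<in> regular_elements R" and d: "d \<in> regular_elements R"
  shows "c \<otimes> d \<in> regular_elements R"
proof -
  note cd = regular_carrier[OF c] regular_carrier[OF d]
  have "b = \<zero>" if b: "b \<in> carrier R" "(c \<otimes> d) \<otimes> b = \<zero>" for b
  proof -
    have "c \<otimes> (d \<otimes> b) = \<zero>"
      using b cd by (simp add: m_assoc)
    then have "d \<otimes> b = \<zero>"
      using regular_left[OF c, of "d \<otimes> b"] b cd by simp
    then show ?thesis
      using regular_left[OF d] b by blast
  qed
  moreover have "b = \<zero>" if b: "b \<in> carrier R" "b \<otimes> (c \<otimes> d) = \<zero>" for b
  proof -
    have "(b \<otimes> c) \<otimes> d = \<zero>"
      using b cd by (simp add: m_assoc)
    then have "b \<otimes> c = \<zero>"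
      using regular_right[OF d, of "b \<otimes> c"] b cd by simp
    then show ?thesis
      using regular_right[OF c] b by blast
  qed
  ultimately show ?thesis
    unfolding regular_elements_def using cd by blast
qed

text \<open>The kernels of the powers of \<open>\<sigma>\<close> stabilise, so \<open>\<sigma>\<close> has no kernel on the image of some
  \<open>\<sigma>\<^sup>N\<close>. That image contains an essential left ideal, which would meet a nonzero kernel.\<close>

lemma inj_if_all_powers_large_image:
  assumes noeth: "left_noetherian R" and \<sigma>: "\<sigma> \<in> ring_hom R R"
    and large: "\<And>n::nat. large_image R (\<sigma> ^^ n)"
  shows "inj_on \<sigma> (carrier R)"
proof -
  have zero: "\<sigma> \<zero> = \<zero>"
    using \<sigma> ring_axioms ring_axioms by (rule ring_hom_zero)
  define K where "K n = {x \<in> carrier R. (\<sigma> ^^ n) x = \<zero>}" for n :: nat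
  have K: "left_ideal (K n) R" for n
  proof -
    note hom = ring_endo_funpow[OF \<sigma>, of n]
    show ?thesis
      unfolding K_def
      by (rule left_idealI)
        (auto simp: ring_hom_add[OF hom] ring_hom_mult[OF hom] ring_hom_closed[OF hom]
          ring_hom_zero[OF hom ring_axioms ring_axioms])
  qed
  have "\<exists>M\<in>range K. \<forall>I\<in>range K. M \<subseteq> I \<longrightarrow> I = M"
    by (rule left_noetherian_has_maximal[OF noeth]) (use K in auto)
  then obtain N where N: "\<forall>n. K N \<subseteq> K n \<longrightarrow> K n = K N"
    by auto
  have "K N \<subseteq> K (Suc N)"
    unfolding K_def using zero by auto
  then have stable: "K (Suc N) = K N"
    using N by blast
  obtain L where L: "essential_left_ideal L R" "L \<subseteq> (\<sigma> ^^ N) ` carrier R"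
    using large[of N] unfolding large_image_def by blast
  have "x = \<zero>" if x: "x \<in> carrier R" "\<sigma> x = \<zero>" for x
  proof (rule ccontr)
    assume "x \<noteq> \<zero>"
    then obtain r where r: "r \<in> carrier R" "r \<otimes> x \<in> L" "r \<otimes> x \<noteq> \<zero>"
      using L(1) x unfolding essential_left_ideal_iff by blast
    then obtain z where z: "z \<in> carrier R" "r \<otimes> x = (\<sigma> ^^ N) z"
      using L(2) by blast
    have "\<sigma> (r \<otimes> x) = \<zero>"
      using ring_hom_mult[OF \<sigma> r(1) x(1)] ring_hom_closed[OF \<sigma> r(1)] x by simp
    then have "z \<in> K (Suc N)"
      unfolding K_def using z by simp
    then show False
      unfolding stable using r z unfolding K_def by simp
  qed
  then show ?thesis
    unfolding ring_endo_inj_iff[OF \<sigma>] by blast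
qed

text \<open>The element is \<open>d = c \<sigma>(c) \<dots> \<sigma>\<^sup>n\<^sup>-\<^sup>1(c)\<close>. Regularity of all \<open>\<sigma>\<^sup>k(d)\<close> is part of the
  statement because the recursion \<open>d \<mapsto> c \<sigma>(d)\<close> applies \<open>\<sigma>\<close> to the previous element.\<close>

lemma regular_multiples_in_power_image:
  assumes \<sigma>: "\<sigma> \<in> ring_hom R R" and c: "c \<in> carrier R"
    and image: "{r \<otimes> c |r. r \<in> carrier R} \<subseteq> \<sigma> ` carrier R"
    and reg: "\<And>k::nat. (\<sigma> ^^ k) c \<in> regular_elements R"
  shows "\<exists>d\<in>carrier R. (\<forall>k::nat. (\<sigma> ^^ k) d \<in> regular_elements R) \<and>
    {r \<otimes> d |r. r \<in> carrier R} \<subseteq> (\<sigma> ^^ n) ` carrier R"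
proof (induction n)
  case 0
  have "(\<sigma> ^^ k) \<one> \<in> regular_elements R" for k :: nat
    using ring_hom_one[OF ring_endo_funpow[OF \<sigma>]] unfolding regular_elements_def by simp
  then show ?case
    by (intro bexI[of _ \<one>]) auto
next
  case (Suc n)
  then obtain d where d: "d \<in> carrier R" "\<And>k::nat. (\<sigma> ^^ k) d \<in> regular_elements R"
    and d_image: "{r \<otimes> d |r. r \<in> carrier R} \<subseteq> (\<sigma> ^^ n) ` carrier R"
    by blast
  have \<sigma>d: "\<sigma> d \<in> carrier R"
    using ring_hom_closed[OF \<sigma> d(1)] .
  have "(\<sigma> ^^ k) (c \<otimes> \<sigma> d) \<in> regular_elements R" for k :: nat
  proof -
    have "(\<sigma> ^^ k) (c \<otimes> \<sigma> d) = (\<sigma> ^^ k) c \<otimes> (\<sigma> ^^ Suc k) d"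
      using ring_hom_mult[OF ring_endo_funpow[OF \<sigma>] c \<sigma>d] by (simp add: funpow_swap1)
    then show ?thesis
      using regular_elements_mult[OF reg d(2)] by (simp only:)
  qed
  moreover have "r \<otimes> (c \<otimes> \<sigma> d) \<in> (\<sigma> ^^ Suc n) ` carrier R" if r: "r \<in> carrier R" for r
  proof -
    obtain x where x: "x \<in> carrier R" "r \<otimes> c = \<sigma> x"
      using image r by blast
    obtain y where y: "y \<in> carrier R" "x \<otimes> d = (\<sigma> ^^ n) y"
      using d_image x by blast
    have "r \<otimes> (c \<otimes> \<sigma> d) = \<sigma> x \<otimes> \<sigma> d"
      using r c \<sigma>d x by (simp add: m_assoc[symmetric])
    also have "\<dots> = (\<sigma> ^^ Suc n) y"
      using ring_hom_mult[OF \<sigma> x(1) d(1)] y by simp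
    finally show ?thesis
      using y by blast
  qed
  ultimately show ?case
    using c \<sigma>d by (intro bexI[of _ "c \<otimes> \<sigma> d"]) auto
qed

lemma large_image_if_regular_multiples:
  assumes noeth: "left_noetherian R" and d: "d \<in> regular_elements R"
    and image: "{r \<otimes> d |r. r \<in> carrier R} \<subseteq> \<tau> ` carrier R"
  shows "large_image R \<tau>"
proof -
  note dR = regular_carrier[OF d]
  have "b = \<zero>" if b: "b \<in> rann R {r \<otimes> d |r. r \<in> carrier R}" for b
  proof -
    have "b \<in> carrier R" and "(\<one> \<otimes> d) \<otimes> b = \<zero>"
      using b unfolding rann_def by blast+
    then show ?thesis
      using regular_left[OF d, of b] dR by simp
  qed
  moreover have "\<zero> \<in> rann R {r \<otimes> d |r. r \<in> carrier R}"
    using dR unfolding rann_def by auto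
  ultimately have "rann R {r \<otimes> d |r. r \<in> carrier R} = {\<zero>}"
    by blast
  then show ?thesis
    unfolding large_image_def
    using essential_principal_if_lann_zero[OF noeth dR lann_regular[OF d]] image by blast
qed

text \<open>If \<open>lann (\<sigma> c)\<close> is nonzero, it meets the essential left ideal inside the image of \<open>\<sigma>\<close> in
  some \<open>\<sigma> x \<noteq> 0\<close>. But \<open>\<sigma> (x c) = 0\<close> forces \<open>x = 0\<close>. So only the left annihilator is accessible
  directly, and regularity on the other side comes from the structure of the ring.\<close>

lemma inj_large_image_preserves_regular:
  assumes semi: "semiprime_ring R" and noeth: "left_noetherian R"
    and \<sigma>: "\<sigma> \<in> ring_hom R R" and large: "large_image R \<sigma>"
    and inj: "inj_on \<sigma> (carrier R)" and c: "c \<in> regular_elements R"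
  shows "\<sigma> c \<in> regular_elements R"
proof (rule regular_if_lann_zero[OF semi noeth])
  note cR = regular_carrier[OF c]
  show \<sigma>c: "\<sigma> c \<in> carrier R"
    using ring_hom_closed[OF \<sigma> cR] .
  obtain L where L: "essential_left_ideal L R" "L \<subseteq> \<sigma> ` carrier R"
    using large unfolding large_image_def by blast
  have "b = \<zero>" if b: "b \<in> lann (\<sigma> c)" for b
  proof (rule ccontr)
    assume "b \<noteq> \<zero>"
    then obtain r where r: "r \<in> carrier R" "r \<otimes> b \<in> L" "r \<otimes> b \<noteq> \<zero>"
      using L(1) b unfolding essential_left_ideal_iff lann_def by blast
    then obtain x where x: "x \<in> carrier R" "r \<otimes> b = \<sigma> x"
      using L(2) by blast
    have "\<sigma> x \<otimes> \<sigma> c = \<zero>"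
      using left_ideal_mult[OF left_ideal_lann[OF \<sigma>c] r(1) b] x unfolding lann_def by simp
    then have "\<sigma> (x \<otimes> c) = \<zero>"
      using ring_hom_mult[OF \<sigma> x(1) cR] by simp
    then have "x \<otimes> c = \<zero>"
      using inj x cR unfolding ring_endo_inj_iff[OF \<sigma>] by simp
    then have "x = \<zero>"
      using regular_right[OF c] x by blast
    then show False
      using r x ring_hom_zero[OF \<sigma> ring_axioms ring_axioms] by simp
  qed
  then show "lann (\<sigma> c) = {\<zero>}"
    using left_ideal_zero[OF left_ideal_lann[OF \<sigma>c]] by blast
qed

end

theorem proposition1p13:
  fixes R :: "('a, 'b) ring_scheme" (structure)
    and \<sigma> :: "'a \<Rightarrow> 'a"
  assumes "ring R"
    and "semiprime_ring R"
    and "left_noetherian R"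
    and "\<sigma> \<in> ring_hom R R"
    and "large_image R \<sigma>"
  shows "(inj_on \<sigma> (carrier R) \<longleftrightarrow> \<sigma> ` regular_elements R \<subseteq> regular_elements R)
       \<and> (inj_on \<sigma> (carrier R) \<longleftrightarrow>
            (\<exists>c\<in>regular_elements R. {r \<otimes> c |r. r \<in> carrier R} \<subseteq> \<sigma> ` carrier R
               \<and> (\<forall>n::nat. (\<sigma> ^^ n) c \<in> regular_elements R)))
       \<and> (inj_on \<sigma> (carrier R) \<longleftrightarrow> (\<forall>n::nat. large_image R (\<sigma> ^^ n)))"
    (is "(?inj \<longleftrightarrow> ?pres) \<and> (?inj \<longleftrightarrow> ?reg) \<and> (?inj \<longleftrightarrow> ?large)")
proof -
  interpret ring R
    by fact
  have "?inj \<Longrightarrow> ?pres"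
    using inj_large_image_preserves_regular[OF assms(2-5)] by blast
  moreover have "?pres \<Longrightarrow> ?reg"
  proof -
    assume pres: ?pres
    obtain L where L: "essential_left_ideal L R" "L \<subseteq> \<sigma> ` carrier R"
      using assms(5) unfolding large_image_def by blast
    obtain c where c: "c \<in> L" "c \<in> regular_elements R"
      using essential_left_ideal_contains_regular[OF assms(2,3) L(1)] .
    have "left_ideal L R"
      using L(1) unfolding essential_left_ideal_def by blast
    then have "{r \<otimes> c |r. r \<in> carrier R} \<subseteq> \<sigma> ` carrier R"
      using c(1) L(2) left_ideal_mult by blast
    moreover have "(\<sigma> ^^ n) c \<in> regular_elements R" for n :: nat
      by (induction n) (use c pres in auto)
    ultimately show ?reg
      using c(2) by blast
  qed
  moreover have "?reg \<Longrightarrow> ?large"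
  proof
    fix n :: nat assume ?reg
    then obtain c where c: "c \<in> regular_elements R"
      "{r \<otimes> c |r. r \<in> carrier R} \<subseteq> \<sigma> ` carrier R"
      "\<And>k::nat. (\<sigma> ^^ k) c \<in> regular_elements R"
      by blast
    then have "c \<in> carrier R"
      unfolding regular_elements_def by blast
    then obtain d where d: "\<forall>k::nat. (\<sigma> ^^ k) d \<in> regular_elements R"
      "{r \<otimes> d |r. r \<in> carrier R} \<subseteq> (\<sigma> ^^ n) ` carrier R"
      using regular_multiples_in_power_image[OF assms(4) _ c(2,3)] by blast
    then have "d \<in> regular_elements R"
      using spec[OF d(1), of 0] by simp
    then show "large_image R (\<sigma> ^^ n)"
      using large_image_if_regular_multiples[OF assms(3)] d(2) by blast
  qed
  moreover have "?large \<Longrightarrow> ?inj"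
    using inj_if_all_powers_large_image[OF assms(3,4)] by blast
  ultimately show ?thesis
    by blast
qed

end
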